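(* Let $\lambda=(m,n)$ be a triangular $2$-partition, let $\theta$ be its top-down tableau, and set $A_\lambda(q,t,1):=\sum_{0\le d\le\min(n,m-n)} s_{(m+n-2d,\,d)}(q,t,1)$. Then $$A_\lambda(q,t,1)=\sum_{\tau\preceq\mu} q^{\mathrm{dist}(\tau,\mu)}\,t^{\mathrm{sim}_\theta(\mu)},$$ where the sum runs over all intervals $\tau\preceq\mu$ of the $\nu$-Tamari lattice of $\lambda$.
   Context: Partitions are drawn in French convention: cell $(\ell,c)$ (row $\ell\ge0$ from the bottom, column $c\ge0$) belongs to $\lambda=(\lambda_1\ge\lambda_2\ge\cdots)$ iff $c<\lambda_{\ell+1}$; rows are also called lines, line $k$ (for $k\ge1$) having $\lambda_k$ cells. A $2$-partition $(m,n)$ has $m\ge n\ge0$. A partition is triangular if there exist positive reals $r,s$ with $\lambda_j=\lfloor r-jr/s\rfloor$ for integers $1\le j\le s$ and $\lambda_j=0$ for $j>s$. Subpartitions $\mu\subseteq\lambda$ satisfy $\mu_k\le\lambda_k$ for all $k$. The top-down tableau of $\lambda$ (with $|\lambda|=N$) is the standard Young tableau obtained by labeling with $N$ the last cell of the top row, with $N-1$ the last cell of the row below, and so on, one cell per nonempty row down to the bottom row, then repeating the process on the remaining cells with the next smaller labels. For a standard Young tableau $\theta$ of shape $\lambda$ and a subpartition $\mu$, a cell $d$ is a $\theta$-deficit cell if there exist cells $c_1=(i_1,j_1)\in\mu$, $c_2=(i_2,j_2)\in\lambda\setminus\mu$ with $\theta(c_1)>\theta(c_2)$ and $d=(\min(i_1,i_2),\min(j_1,j_2))$;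 $\mathrm{sim}_\theta(\mu)$ is the number of cells of $\mu$ that are not $\theta$-deficit cells. $\nu$-Tamari lattice: for a subpartition $\mu$ of $\lambda$ and a line $j\ge1$ with $\mu_j>\mu_{j+1}$, let $v=\lambda_j-\mu_j$ and let $i$ be the smallest integer with $0\le i<j$ such that $\lambda_k-\mu_k>v$ for all $i<k<j$; the rotation of $\mu$ at line $j$ is $\alpha$ with $\alpha_k=\mu_k-1$ for $i<k\le j$ and $\alpha_k=\mu_k$ otherwise. The $\nu$-Tamari order $\preceq$ on subpartitions of $\lambda$ is the reflexive-transitive closure of "$\mu\preceq\alpha$ when $\alpha$ is a rotation of $\mu$" (it is a lattice). For $\tau\preceq\mu$, $\mathrm{dist}(\tau,\mu)$ is the length of a longest chain from $\tau$ to $\mu$. For integers $b\ge a\ge0$, $s_{(b,a)}(q,t,1)=\sum_{T}q^{T_1}t^{T_2}$, summed over semi-standard Young tableaux $T$ of shape $(b,a)$ (entries weakly increasing along rows, strictly increasing up columns) with entries in $\{1,2,3\}$, where $T_i$ is the number of entries equal to $i$ (i.e. the Schur polynomial $s_{(b,a)}(q,t,r)$ evaluated at $r=1$). *)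

theory Defs
  imports Complex_Main "HOL-Library.FuncSet"
begin

text \<open>
  A partition is the function sending a row index \<open>l \<ge> 0\<close>, counted from the bottom, to the
  length of that row; so line \<open>k \<ge> 1\<close> of \<open>lam\<close>, written \<open>\<lambda>\<^sub>k\<close> on paper, is \<open>lam (k - 1)\<close>.
\<close>

definition partition :: "(nat \<Rightarrow> nat) \<Rightarrow> bool" where
  "partition lam \<longleftrightarrow> antimono lam \<and> finite {l. lam l \<noteq> 0}"

definition line :: "(nat \<Rightarrow> nat) \<Rightarrow> nat \<Rightarrow> nat" where
  "line lam k = lam (k - 1)"

definition two_part :: "nat \<Rightarrow> nat \<Rightarrow> nat \<Rightarrow> nat" where
  "two_part m n = (\<lambda>l. if l = 0 then m else if l = 1 then n else 0)"

definition cells :: "(nat \<Rightarrow> nat) \<Rightarrow> (nat \<times> nat) set" where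
  "cells lam = {(l, c). c < lam l}"

definition triangular :: "(nat \<Rightarrow> nat) \<Rightarrow> bool" where
  "triangular lam \<longleftrightarrow>
     partition lam \<and>
     (\<exists>r s :: real. r > 0 \<and> s > 0 \<and>
       (\<forall>j\<ge>1. (real j \<le> s \<longrightarrow> int (line lam j) = \<lfloor>r - real j * r / s\<rfloor>) \<and>
               (real j > s \<longrightarrow> line lam j = 0)))"

definition subpartitions :: "(nat \<Rightarrow> nat) \<Rightarrow> (nat \<Rightarrow> nat) set" where
  "subpartitions lam = {mu. partition mu \<and> (\<forall>l. mu l \<le> lam l)}"

definition num_rows :: "(nat \<Rightarrow> nat) \<Rightarrow> nat" where
  "num_rows lam = card {l. lam l \<noteq> 0}"

definition last_cells :: "(nat \<Rightarrow> nat) \<Rightarrow> (nat \<times> nat) list" where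
  "last_cells lam = map (\<lambda>l. (l, lam l - 1)) (rev [0..<num_rows lam])"

text \<open>
  After \<open>p\<close> rounds every row has lost its last \<open>p\<close> cells (or has become empty), so the
  remaining cells form the partition \<open>\<lambda>l. lam l - p\<close>, and nothing remains after \<open>lam 0\<close> rounds.
\<close>

definition top_down_order :: "(nat \<Rightarrow> nat) \<Rightarrow> (nat \<times> nat) list" where
  "top_down_order lam = concat (map (\<lambda>p. last_cells (\<lambda>l. lam l - p)) [0..<lam 0])"

text \<open>
  The cells in this order receive the labels \<open>N, N - 1, \<dots>, 1\<close>, where \<open>N\<close> is the number of
  cells. Values outside \<open>cells lam\<close> carry no meaning.
\<close>

definition top_down :: "(nat \<Rightarrow> nat) \<Rightarrow> nat \<times> nat \<Rightarrow> nat" where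
  "top_down lam c =
     the (map_of (zip (top_down_order lam) (rev [1..<Suc (card (cells lam))])) c)"

definition deficit_cells ::
    "(nat \<Rightarrow> nat) \<Rightarrow> (nat \<times> nat \<Rightarrow> nat) \<Rightarrow> (nat \<Rightarrow> nat) \<Rightarrow> (nat \<times> nat) set" where
  "deficit_cells lam theta mu =
     {(min i1 i2, min j1 j2) | i1 j1 i2 j2.
        (i1, j1) \<in> cells mu \<and> (i2, j2) \<in> cells lam - cells mu \<and>
        theta (i1, j1) > theta (i2, j2)}"

definition sim :: "(nat \<Rightarrow> nat) \<Rightarrow> (nat \<times> nat \<Rightarrow> nat) \<Rightarrow> (nat \<Rightarrow> nat) \<Rightarrow> nat" where
  "sim lam theta mu = card (cells mu - deficit_cells lam theta mu)"

definition rotation_start :: "(nat \<Rightarrow> nat) \<Rightarrow> (nat \<Rightarrow> nat) \<Rightarrow> nat \<Rightarrow> nat" where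
  "rotation_start lam mu j =
     (LEAST i. i < j \<and>
        (\<forall>k. i < k \<and> k < j \<longrightarrow> line lam k - line mu k > line lam j - line mu j))"

text \<open>Row \<open>l\<close> is line \<open>l + 1\<close>.\<close>

definition rotation :: "(nat \<Rightarrow> nat) \<Rightarrow> (nat \<Rightarrow> nat) \<Rightarrow> nat \<Rightarrow> nat \<Rightarrow> nat" where
  "rotation lam mu j =
     (\<lambda>l. if rotation_start lam mu j < l + 1 \<and> l + 1 \<le> j then mu l - 1 else mu l)"

definition is_rotation :: "(nat \<Rightarrow> nat) \<Rightarrow> (nat \<Rightarrow> nat) \<Rightarrow> (nat \<Rightarrow> nat) \<Rightarrow> bool" where
  "is_rotation lam mu alpha \<longleftrightarrow>
     mu \<in> subpartitions lam \<and>
     (\<exists>j\<ge>1. line mu j > line mu (j + 1) \<and> alpha = rotation lam mu j)"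

definition tamari_le :: "(nat \<Rightarrow> nat) \<Rightarrow> (nat \<Rightarrow> nat) \<Rightarrow> (nat \<Rightarrow> nat) \<Rightarrow> bool" where
  "tamari_le lam tau mu \<longleftrightarrow>
     tau \<in> subpartitions lam \<and> mu \<in> subpartitions lam \<and> (is_rotation lam)\<^sup>*\<^sup>* tau mu"

definition tamari_less_rel :: "(nat \<Rightarrow> nat) \<Rightarrow> ((nat \<Rightarrow> nat) \<times> (nat \<Rightarrow> nat)) set" where
  "tamari_less_rel lam = {(tau, mu). tamari_le lam tau mu \<and> tau \<noteq> mu}"

text \<open>
  A pair lies in the \<open>k\<close>-th relational power of the strict order iff it is joined by a
  chain of length \<open>k\<close>, that is, a chain with \<open>k + 1\<close> elements.
\<close>

definition tamari_dist :: "(nat \<Rightarrow> nat) \<Rightarrow> (nat \<Rightarrow> nat) \<Rightarrow> (nat \<Rightarrow> nat) \<Rightarrow> nat" where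
  "tamari_dist lam tau mu = (GREATEST k. (tau, mu) \<in> tamari_less_rel lam ^^ k)"

definition tamari_intervals :: "(nat \<Rightarrow> nat) \<Rightarrow> ((nat \<Rightarrow> nat) \<times> (nat \<Rightarrow> nat)) set" where
  "tamari_intervals lam = {(tau, mu). tamari_le lam tau mu}"

definition ssyt :: "nat \<Rightarrow> (nat \<Rightarrow> nat) \<Rightarrow> (nat \<times> nat \<Rightarrow> nat) set" where
  "ssyt k lam =
     {T \<in> cells lam \<rightarrow>\<^sub>E {1..k}.
        (\<forall>l c. (l, c + 1) \<in> cells lam \<longrightarrow> T (l, c) \<le> T (l, c + 1)) \<and>
        (\<forall>l c. (l + 1, c) \<in> cells lam \<longrightarrow> T (l, c) < T (l + 1, c))}"

definition content :: "(nat \<Rightarrow> nat) \<Rightarrow> (nat \<times> nat \<Rightarrow> nat) \<Rightarrow> nat \<Rightarrow> nat" where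
  "content lam T i = card {c \<in> cells lam. T c = i}"

definition schur3 :: "(nat \<Rightarrow> nat) \<Rightarrow> 'a::comm_ring_1 \<Rightarrow> 'a \<Rightarrow> 'a \<Rightarrow> 'a" where
  "schur3 lam q t r =
     (\<Sum>T \<in> ssyt 3 lam. q ^ content lam T 1 * t ^ content lam T 2 * r ^ content lam T 3)"

definition A_poly :: "nat \<Rightarrow> nat \<Rightarrow> 'a::comm_ring_1 \<Rightarrow> 'a \<Rightarrow> 'a \<Rightarrow> 'a" where
  "A_poly m n q t r = (\<Sum>d \<le> min n (m - n). schur3 (two_part (m + n - 2 * d) d) q t r)"

end

(* Write a subpartition of (m, n) as (m - x, n - y). In these coordinates the Tamari order is a
   product order in (x, y) where x <= y and a product order in (x - y, y) where x > y, and
   dist is x' - x + y' - y for intervals starting in the first region and x' - x for those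
   starting in the second. Hence the q-weights of the intervals below (x, y) fill the
   segments {i .. |x - y| + 2i} for i <= min x y. On the Schur side, fixing the power of t
   also splits the q-weights into segments. The segments do not correspond to one another,
   but a sum of q^p over a segment is a difference of two values of [h] = 1 + ... + q^(h-1),
   and the multisets of upper ends, and of lower ends, on the two sides agree. *)
theory Submission
  imports Defs
begin

section \<open>Geometric sums\<close>

definition geom :: "'a::comm_ring_1 \<Rightarrow> nat \<Rightarrow> 'a" where
  "geom q h = (\<Sum>p<h. q ^ p)"

lemma sum_power_atLeastAtMost:
  assumes "a \<le> b + 1"
  shows "(\<Sum>p = a..b. q ^ p) = geom q (b + 1) - geom q a"
proof -
  have "{..<b + 1} = {..<a} \<union> {a..b}" "{..<a} \<inter> {a..b} = {}"
    using assms by auto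
  then have "geom q (b + 1) = geom q a + (\<Sum>p = a..b. q ^ p)"
    unfolding geom_def by (simp add: sum.union_disjoint)
  then show ?thesis by simp
qed

section \<open>Semistandard tableaux with two rows\<close>

lemma cells_two_part: "cells (two_part B A) = {0} \<times> {..<B} \<union> {1} \<times> {..<A}"
  unfolding cells_def two_part_def by (auto split: if_splits)

text \<open>Serves to read off tableau rows: in a weakly increasing row the entries at most k fill
  the first cells, so their number tells where they stand.\<close>

lemma initial_segment:
  fixes P :: "nat \<Rightarrow> bool"
  assumes "\<And>c. c + 1 < B \<Longrightarrow> P (c + 1) \<Longrightarrow> P c"
  shows "\<forall>c<B. P c \<longleftrightarrow> c < card {c. c < B \<and> P c}"
  using assms
proof (induction B)
  case (Suc B)
  then have IH: "\<forall>c<B. P c \<longleftrightarrow> c < card {c. c < B \<and> P c}" by simp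
  show ?case
  proof (cases "P B")
    case True
    have "P (B - j)" if "j \<le> B" for j
      using that
    proof (induction j)
      case (Suc j)
      then show ?case using Suc.prems \<open>\<And>c. c + 1 < Suc B \<Longrightarrow> P (c + 1) \<Longrightarrow> P c\<close>[of "B - Suc j"]
        by (simp add: Suc_diff_Suc)
    qed (use True in simp)
    then have all: "P c" if "c \<le> B" for c
      using that by (metis diff_diff_cancel diff_le_self)
    then have "{c. c < Suc B \<and> P c} = {..<Suc B}" by auto
    then show ?thesis using all by simp
  next
    case False
    then have eq: "{c. c < Suc B \<and> P c} = {c. c < B \<and> P c}"
      by (auto simp: less_Suc_eq)
    have "card {c. c < B \<and> P c} \<le> card {..<B}"
      by (rule card_mono) auto
    then show ?thesis unfolding eq using IH False by (auto simp: less_Suc_eq)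
  qed
qed simp

text \<open>Normal form of a tableau: when \<open>p \<le> s\<close>, row 0 has \<open>p\<close>
  entries 1 and \<open>s - p\<close> entries 2, and row 1 has \<open>r\<close> entries 2. Column
  strictness leaves no 1 in row 1. \<open>restrict\<close> makes the function extensional, as
  \<open>ssyt\<close> demands.\<close>

definition two_row_tableau :: "nat \<Rightarrow> nat \<Rightarrow> nat \<Rightarrow> nat \<Rightarrow> nat \<Rightarrow> nat \<times> nat \<Rightarrow> nat" where
  "two_row_tableau B A p s r = restrict
     (\<lambda>(l, c). if l = 0 then (if c < p then 1 else if c < s then 2 else 3)
               else if c < r then 2 else 3) (cells (two_part B A))"

lemma two_row_tableau_simps:
  "c < B \<Longrightarrow> two_row_tableau B A p s r (0, c) = (if c < p then 1 else if c < s then 2 else 3)"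
  "c < A \<Longrightarrow> two_row_tableau B A p s r (Suc 0, c) = (if c < r then 2 else 3)"
  by (auto simp: two_row_tableau_def cells_two_part)

lemma two_row_tableau_ssyt:
  assumes "A \<le> s" "s \<le> B" "r \<le> p"
  shows "two_row_tableau B A p s r \<in> ssyt 3 (two_part B A)"
proof -
  have "two_row_tableau B A p s r \<in> cells (two_part B A) \<rightarrow>\<^sub>E {1..3}"
    unfolding two_row_tableau_def restrict_PiE_iff by auto
  then show ?thesis
    using assms unfolding ssyt_def by (auto simp: two_row_tableau_simps cells_two_part)
qed

lemma content_two_row_tableau:
  assumes "p \<le> s" "s \<le> B" "r \<le> A"
  shows "content (two_part B A) (two_row_tableau B A p s r) 1 = p"
    and "content (two_part B A) (two_row_tableau B A p s r) 2 = s - p + r"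
proof -
  have "{c \<in> cells (two_part B A). two_row_tableau B A p s r c = 1} = {0} \<times> {..<p}"
    using assms by (auto simp: two_row_tableau_def cells_two_part split: if_splits)
  then show "content (two_part B A) (two_row_tableau B A p s r) 1 = p"
    unfolding content_def by (simp add: card_cartesian_product)
  have "{c \<in> cells (two_part B A). two_row_tableau B A p s r c = 2} = {0} \<times> {p..<s} \<union> {1} \<times> {..<r}"
    using assms by (auto simp: two_row_tableau_def cells_two_part split: if_splits)
  moreover have "card ({0::nat} \<times> {p..<s} \<union> {1} \<times> {..<r}) = s - p + r"
    by (subst card_Un_disjoint) (auto simp: card_cartesian_product)
  ultimately show "content (two_part B A) (two_row_tableau B A p s r) 2 = s - p + r"
    unfolding content_def by simp
qed

text \<open>By \<open>initial_segment\<close> the counts mark where the entries of a row change, so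
  they recover \<open>T\<close>. Column strictness puts a 1 below each 2 of row 1, hence
  \<open>r \<le> p\<close>, and no 3 below row 1, hence \<open>A \<le> s\<close>.\<close>

lemma ssyt_two_part_cases:
  assumes "A \<le> B" and T: "T \<in> ssyt 3 (two_part B A)"
  defines "p \<equiv> card {c. c < B \<and> T (0, c) \<le> 1}"
    and "s \<equiv> card {c. c < B \<and> T (0, c) \<le> 2}"
    and "r \<equiv> card {c. c < A \<and> T (1, c) \<le> 2}"
  shows "p \<le> s" "s \<le> B" "r \<le> A" "r \<le> p" "A \<le> s" "two_row_tableau B A p s r = T"
proof -
  have PiE: "T \<in> cells (two_part B A) \<rightarrow>\<^sub>E {1..3}"
    and weak: "\<And>l c. (l, c + 1) \<in> cells (two_part B A) \<Longrightarrow> T (l, c) \<le> T (l, c + 1)"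
    and strict: "\<And>l c. (l + 1, c) \<in> cells (two_part B A) \<Longrightarrow> T (l, c) < T (l + 1, c)"
    using T unfolding ssyt_def by blast+
  have range: "T (0, c) \<in> {1..3}" if "c < B" for c
    using PiE_mem[OF PiE, of "(0, c)"] that by (simp add: cells_two_part)
  have range': "T (1, c) \<in> {1..3}" if "c < A" for c
    using PiE_mem[OF PiE, of "(1, c)"] that by (simp add: cells_two_part)
  have row: "T (0, c) \<le> T (0, c + 1)" if "c + 1 < B" for c
    using weak[of 0 c] that by (simp add: cells_two_part)
  have row': "T (1, c) \<le> T (1, c + 1)" if "c + 1 < A" for c
    using weak[of 1 c] that by (simp add: cells_two_part)
  have col: "T (0, c) < T (1, c)" if "c < A" for c
    using strict[of 0 c] that by (simp add: cells_two_part)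
  have p: "\<forall>c<B. T (0, c) \<le> 1 \<longleftrightarrow> c < p"
    unfolding p_def using row by (intro initial_segment) (meson le_trans)
  have s: "\<forall>c<B. T (0, c) \<le> 2 \<longleftrightarrow> c < s"
    unfolding s_def using row by (intro initial_segment) (meson le_trans)
  have r: "\<forall>c<A. T (1, c) \<le> 2 \<longleftrightarrow> c < r"
    unfolding r_def using row' by (intro initial_segment) (meson le_trans)
  show "p \<le> s" unfolding p_def s_def by (rule card_mono) auto
  have "s \<le> card {..<B}" unfolding s_def by (rule card_mono) auto
  then show "s \<le> B" by simp
  have "r \<le> card {..<A}" unfolding r_def by (rule card_mono) auto
  then show "r \<le> A" by simp
  have "c < p" if "c < r" for c
  proof -
    have "c < A" "c < B" using that \<open>r \<le> A\<close> \<open>A \<le> B\<close> by auto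
    then have "T (1, c) \<le> 2" "T (0, c) < T (1, c)" using that r col by auto
    then have "T (0, c) \<le> 1" by linarith
    then show "c < p" using p \<open>c < B\<close> by blast
  qed
  then show "r \<le> p" using not_less by blast
  have "c < s" if "c < A" for c
  proof -
    have "T (0, c) \<le> 2" using col[OF that] range'[OF that] by simp
    then show "c < s" using s that \<open>A \<le> B\<close> by simp
  qed
  then show "A \<le> s" using not_less by blast
  show "two_row_tableau B A p s r = T"
  proof
    fix z :: "nat \<times> nat"
    obtain l c where z: "z = (l, c)" by force
    show "two_row_tableau B A p s r z = T z"
    proof (cases "z \<in> cells (two_part B A)")
      case True
      consider "l = 0" "c < B" | "l = 1" "c < A" using True z by (auto simp: cells_two_part)
      then show ?thesis
      proof cases
        case 1
        then have "T (0, c) \<le> 1 \<longleftrightarrow> c < p" "T (0, c) \<le> 2 \<longleftrightarrow> c < s" "T (0, c) \<in> {1..3}"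
          using p s range by auto
        then show ?thesis using 1 z by (auto simp: two_row_tableau_simps)
      next
        case 2
        then have "T (1, c) \<le> 2 \<longleftrightarrow> c < r" "T (1, c) \<in> {1..3}" "T (1, c) > T (0, c)" "T (0, c) \<in> {1..3}"
          using r range' col range \<open>A \<le> B\<close> by auto
        then show ?thesis using 2 z by (auto simp: two_row_tableau_simps)
      qed
    next
      case False
      then have "T z = undefined" using PiE by (rule PiE_arb[rotated])
      then show ?thesis using False by (simp add: two_row_tableau_def restrict_def)
    qed
  qed
qed

section \<open>Schur polynomials with third variable 1\<close>

lemma schur3_two_part_parameters:
  fixes q t :: "'a::comm_ring_1"
  assumes "A \<le> B"
  shows "schur3 (two_part B A) q t 1 =
    (\<Sum>(p, s, r) \<in> {(p, s, r). p \<le> s \<and> s \<le> B \<and> r \<le> A \<and> r \<le> p \<and> A \<le> s}.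
       q ^ p * t ^ (s - p + r))"
  unfolding schur3_def
proof (rule sum.reindex_bij_witness[symmetric, where
    j = "\<lambda>(p, s, r). two_row_tableau B A p s r" and
    i = "\<lambda>T. (card {c. c < B \<and> T (0, c) \<le> 1}, card {c. c < B \<and> T (0, c) \<le> 2},
             card {c. c < A \<and> T (1, c) \<le> 2})"], goal_cases)
  case (1 a)
  then obtain p s r where a: "a = (p, s, r)" "p \<le> s" "s \<le> B" "r \<le> A" "r \<le> p" "A \<le> s" by auto
  have "{c. c < B \<and> two_row_tableau B A p s r (0, c) \<le> 1} = {..<p}"
    "{c. c < B \<and> two_row_tableau B A p s r (0, c) \<le> 2} = {..<s}"
    "{c. c < A \<and> two_row_tableau B A p s r (1, c) \<le> 2} = {..<r}"
    using a by (auto simp: two_row_tableau_simps split: if_splits)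
  then show ?case using a by simp
next
  case (2 a)
  then show ?case using two_row_tableau_ssyt by auto
next
  case (3 T)
  then show ?case using ssyt_two_part_cases(6)[OF assms 3] by simp
next
  case (4 T)
  then show ?case using ssyt_two_part_cases(1-5)[OF assms 4] by simp
next
  case (5 a)
  then show ?case by (auto simp: content_two_row_tableau simp del: One_nat_def)
qed

text \<open>
  Here \<open>T\<close> is the number of entries 2, and \<open>r\<close> counts those in the upper row; the number of
  entries 1 then ranges over a segment.
\<close>

definition schur_geom :: "'a::comm_ring_1 \<Rightarrow> 'a \<Rightarrow> nat \<Rightarrow> nat \<Rightarrow> 'a" where
  "schur_geom q t B A = (\<Sum>T\<le>B. \<Sum>r\<le>min A T. t ^ T * (geom q (B + r - T + 1) - geom q (r + (A - T))))"

text \<open>Put \<open>T = s - p + r\<close>, so \<open>s = T + p - r\<close>. For fixed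
  \<open>T\<close> and \<open>r\<close>, the conditions \<open>r \<le> p\<close> and
  \<open>A \<le> s\<close> combine to \<open>r + (A - T) \<le> p\<close>, truncated subtraction
  taking the larger bound; \<open>s \<le> B\<close> gives the upper end, and
  \<open>p \<le> s\<close> becomes \<open>r \<le> T\<close>.\<close>

lemma schur3_two_part:
  fixes q t :: "'a::comm_ring_1"
  assumes "A \<le> B"
  shows "schur3 (two_part B A) q t 1 = schur_geom q t B A"
proof -
  have "schur3 (two_part B A) q t 1 =
    (\<Sum>(T, r, p) \<in> (SIGMA T:{..B}. SIGMA r:{..min A T}. {r + (A - T)..B + r - T}). t ^ T * q ^ p)"
    unfolding schur3_two_part_parameters[OF assms]
    by (rule sum.reindex_bij_witness[where
          j = "\<lambda>(p, s, r). (s - p + r, r, p)" and i = "\<lambda>(T, r, p). (p, T + p - r, r)"])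
       (auto simp: mult.commute)
  also have "\<dots> = (\<Sum>T\<le>B. \<Sum>r\<le>min A T. \<Sum>p = r + (A - T)..B + r - T. t ^ T * q ^ p)"
    by (simp add: sum.Sigma[symmetric])
  also have "\<dots> = schur_geom q t B A"
    unfolding schur_geom_def using assms
    by (intro sum.cong refl) (simp add: sum_distrib_left[symmetric] sum_power_atLeastAtMost)
  finally show ?thesis .
qed

text \<open>
  If \<open>m = 2n - 1\<close>, the sum defining \<open>A_poly\<close> stops at \<open>n - 1\<close>; by the following lemma its
  extension to \<open>d = n\<close> adds nothing.
\<close>

lemma schur_geom_Suc: "schur_geom q t A (Suc A) = 0"
  unfolding schur_geom_def by (intro sum.neutral ballI) (auto simp: Suc_diff_le add.commute)

lemma A_poly_schur_geom:
  fixes q t :: "'a::comm_ring_1"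
  assumes "n \<le> m" "2 * n \<le> m + 1"
  shows "A_poly m n q t 1 = (\<Sum>d\<le>n. schur_geom q t (m + n - 2 * d) d)"
proof -
  \<comment> \<open>Each shape is a partition: d <= n and d <= m - n give 3d <= 2n + (m - n) = m +
    n.\<close>
  have "A_poly m n q t 1 = (\<Sum>d\<le>min n (m - n). schur_geom q t (m + n - 2 * d) d)"
    unfolding A_poly_def using assms by (intro sum.cong refl schur3_two_part) auto
  also have "\<dots> = (\<Sum>d\<le>n. schur_geom q t (m + n - 2 * d) d)"
  proof (cases "n \<le> m - n")
    case False
    then have m: "m = 2 * n - 1" "n > 0" using assms by auto
    then obtain n' where n': "n = Suc n'" using gr0_conv_Suc by blast
    have "m - n = n'" "m + n - 2 * Suc n' = n'" using m n' by auto
    then show ?thesis using n' schur_geom_Suc[of q t n'] by (simp add: min_def)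
  qed (simp add: min_def)
  finally show ?thesis .
qed

section \<open>A numerical consequence of triangularity\<close>

lemma triangular_two_part:
  assumes "triangular (two_part m n)"
  shows "2 * n \<le> m + 1"
proof (cases "n = 0")
  case False
  obtain r s :: real where rs: "r > 0" "s > 0" and
    h: "\<And>j. j \<ge> 1 \<Longrightarrow> (real j \<le> s \<longrightarrow> int (line (two_part m n) j) = \<lfloor>r - real j * r / s\<rfloor>) \<and>
               (real j > s \<longrightarrow> line (two_part m n) j = 0)"
    using assms unfolding triangular_def by blast
  define d where "d = r / s"
  have s2: "s \<ge> 2" using h[of 2] False by (force simp: line_def two_part_def)
  have m: "int m = \<lfloor>r - d\<rfloor>" using h[of 1] s2 by (simp add: line_def two_part_def d_def)
  have n: "int n = \<lfloor>r - 2 * d\<rfloor>" using h[of 2] s2 by (simp add: line_def two_part_def d_def)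
  have "r - 3 * d < 1"
  proof (cases "s \<ge> 3")
    case True
    then have "\<lfloor>r - 3 * d\<rfloor> = 0" using h[of 3] by (simp add: line_def two_part_def d_def)
    then show ?thesis by linarith
  next
    case False
    then have "r < 3 * d" using rs by (simp add: d_def field_simps)
    then show ?thesis by linarith
  qed
  then show ?thesis using m n by linarith
qed simp

section \<open>Subpartitions and rotations in coordinates\<close>

definition points :: "nat \<Rightarrow> nat \<Rightarrow> (nat \<times> nat) set" where
  "points m n = {(x, y). y \<le> n \<and> x + n \<le> y + m}"

definition subpart :: "nat \<Rightarrow> nat \<Rightarrow> nat \<times> nat \<Rightarrow> nat \<Rightarrow> nat" where
  "subpart m n = (\<lambda>(x, y). two_part (m - x) (n - y))"

text \<open>
  The two disjuncts are the rotations at lines 1 and 2; \<open>y < x\<close> says that line 1 lies deeper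
  inside \<open>\<lambda>\<close> than line 2, in which case the rotation at line 2 shortens both lines.
\<close>

definition pstep :: "nat \<Rightarrow> nat \<Rightarrow> nat \<times> nat \<Rightarrow> nat \<times> nat \<Rightarrow> bool" where
  "pstep m n = (\<lambda>(x, y) z.
     (x + n < y + m \<and> z = (Suc x, y)) \<or>
     (y < n \<and> z = (if y < x then Suc x else x, Suc y)))"

definition ple :: "nat \<times> nat \<Rightarrow> nat \<times> nat \<Rightarrow> bool" where
  "ple = (\<lambda>(x, y) (x', y'). x \<le> x' \<and> y \<le> y' \<and> (y < x \<longrightarrow> x + y' \<le> x' + y))"

text \<open>Where \<open>y < x\<close>, every step raises \<open>x\<close> by exactly 1. From
  \<open>x \<le> y\<close>, a longest path raises \<open>y\<close> first and then \<open>x\<close>,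
  one unit per step.\<close>

definition pdist :: "nat \<times> nat \<Rightarrow> nat \<times> nat \<Rightarrow> nat" where
  "pdist = (\<lambda>(x, y) (x', y'). x' - x + (if y < x then 0 else y' - y))"

lemma finite_points: "finite (points m n)"
proof (rule finite_subset)
  show "points m n \<subseteq> {..m + n} \<times> {..n}" by (auto simp: points_def)
qed simp

lemma inj_on_subpart: "inj_on (subpart m n) (points m n)"
proof (rule inj_onI)
  fix a b assume ab: "a \<in> points m n" "b \<in> points m n" "subpart m n a = subpart m n b"
  then have "subpart m n a 0 = subpart m n b 0" "subpart m n a 1 = subpart m n b 1"
    by simp_all
  with ab(1,2) show "a = b"
    by (auto simp: points_def subpart_def two_part_def)
qed

lemma partition_two_part: "partition (two_part a b) \<longleftrightarrow> b \<le> a"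
proof
  assume "partition (two_part a b)"
  then have "two_part a b 1 \<le> two_part a b 0" by (auto simp: partition_def antimono_def)
  then show "b \<le> a" by (simp add: two_part_def)
next
  assume "b \<le> a"
  have "{l. two_part a b l \<noteq> 0} \<subseteq> {0, 1}" by (auto simp: two_part_def split: if_splits)
  then have "finite {l. two_part a b l \<noteq> 0}" by (rule finite_subset) simp
  then show "partition (two_part a b)"
    using \<open>b \<le> a\<close> by (auto simp: partition_def antimono_def two_part_def)
qed

lemma subpartitions_two_part:
  assumes "n \<le> m"
  shows "subpartitions (two_part m n) = subpart m n ` points m n"
proof (intro equalityI subsetI)
  fix mu assume mu: "mu \<in> subpartitions (two_part m n)"
  then have le: "mu 0 \<le> m" "mu 1 \<le> n" and z: "l \<ge> 2 \<Longrightarrow> mu l = 0" for l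
    by (auto simp: subpartitions_def two_part_def dest: spec[of _ 0] spec[of _ 1] spec[of _ l])
  have "mu = two_part (mu 0) (mu 1)"
    using z by (auto simp: fun_eq_iff two_part_def)
  moreover have "mu 1 \<le> mu 0" using mu by (auto simp: subpartitions_def partition_def antimono_def)
  ultimately have "mu = subpart m n (m - mu 0, n - mu 1)" "(m - mu 0, n - mu 1) \<in> points m n"
    using le by (auto simp: subpart_def points_def)
  then show "mu \<in> subpart m n ` points m n" by blast
next
  fix mu assume "mu \<in> subpart m n ` points m n"
  then obtain x y where "(x, y) \<in> points m n" "mu = two_part (m - x) (n - y)"
    by (auto simp: subpart_def)
  then show "mu \<in> subpartitions (two_part m n)"
    by (auto simp: subpartitions_def partition_two_part points_def) (auto simp: two_part_def)
qed

lemma pstep_points: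
  assumes "p \<in> points m n" "pstep m n p z"
  shows "z \<in> points m n"
  using assms by (auto simp: points_def pstep_def split: if_splits)

lemma rotation_start_1: "rotation_start lam mu 1 = 0"
  unfolding rotation_start_def by (rule Least_equality) auto

lemma rotation_start_2:
  "rotation_start lam mu 2 = (if lam 0 - mu 0 > lam 1 - mu 1 then 0 else 1)"
proof -
  have eq: "i < 2 \<and> (\<forall>k. i < k \<and> k < 2 \<longrightarrow> line lam 2 - line mu 2 < line lam k - line mu k)
    \<longleftrightarrow> i = 1 \<or> (i = 0 \<and> lam 1 - mu 1 < lam 0 - mu 0)" for i :: nat
  proof -
    have k1: "0 < k \<and> k < 2 \<longleftrightarrow> k = 1" for k :: nat by auto
    show ?thesis
      by (cases "i = 0") (auto simp: line_def k1)
  qed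
  show ?thesis
    unfolding rotation_start_def eq by (auto intro!: Least_equality)
qed

lemma is_rotation_subpart:
  assumes "n \<le> m" and p: "p \<in> points m n"
  shows "is_rotation (two_part m n) (subpart m n p) alpha \<longleftrightarrow>
    (\<exists>z. pstep m n p z \<and> alpha = subpart m n z)"
proof -
  obtain x y where xy: "p = (x, y)" "y \<le> n" "x + n \<le> y + m"
    using p by (auto simp: points_def)
  let ?l = "two_part m n" and ?mu = "subpart m n p"
  have mu: "?mu = two_part (m - x) (n - y)" using xy by (simp add: subpart_def)
  have r1: "rotation ?l ?mu 1 = subpart m n (Suc x, y)"
    unfolding rotation_def rotation_start_1 mu
    by (auto simp: fun_eq_iff subpart_def two_part_def)
  have r2: "rotation ?l ?mu 2 = subpart m n (if y < x then Suc x else x, Suc y)" 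
    unfolding rotation_def rotation_start_2 mu using xy
    by (auto simp: fun_eq_iff subpart_def two_part_def)
  have d: "line ?mu j > line ?mu (j + 1) \<longleftrightarrow> (j = 1 \<and> x + n < y + m) \<or> (j = 2 \<and> y < n)" 
    if j1: "j \<ge> 1" for j
  proof -
    consider "j = 1" | "j = 2" | "j \<ge> 3" using j1 by linarith
    then show ?thesis unfolding mu using xy(2,3) by cases (auto simp: line_def two_part_def)
  qed
  have "?mu \<in> subpartitions ?l" using p assms(1) subpartitions_two_part by blast
  then have "is_rotation ?l ?mu alpha \<longleftrightarrow>
      (\<exists>j\<ge>1. ((j = 1 \<and> x + n < y + m) \<or> (j = 2 \<and> y < n)) \<and> alpha = rotation ?l ?mu j)"
    unfolding is_rotation_def using d by blast
  also have "\<dots> \<longleftrightarrow>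
      (x + n < y + m \<and> alpha = rotation ?l ?mu 1) \<or> (y < n \<and> alpha = rotation ?l ?mu 2)"
    by (auto intro: exI[of _ 2])
  finally have "is_rotation ?l ?mu alpha \<longleftrightarrow>
      (x + n < y + m \<and> alpha = rotation ?l ?mu 1) \<or> (y < n \<and> alpha = rotation ?l ?mu 2)" .
  then show ?thesis unfolding r1 r2 by (auto simp: pstep_def xy)
qed

section \<open>The order on pairs and its longest chains\<close>

lemma ple_refl: "ple p p" by (auto simp: ple_def)

lemma ple_trans: "ple p z \<Longrightarrow> ple z w \<Longrightarrow> ple p w"
  by (auto simp: ple_def split: prod.splits)

lemma pstep_ple: "pstep m n p z \<Longrightarrow> ple p z \<and> p \<noteq> z"
  by (auto simp: pstep_def ple_def split: if_splits)

text \<open>Bounds chain lengths from above. Where \<open>y < x\<close>, equal first coordinates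
  would force \<open>p = z\<close>, so \<open>x\<close> grows; a move from \<open>x \<le> y\<close>
  into that region crosses the diagonal and also raises \<open>x\<close>.\<close>

lemma pdist_superadditive:
  assumes "ple p z" "p \<noteq> z" "ple z w"
  shows "Suc (pdist z w) \<le> pdist p w"
  using assms by (auto simp: ple_def pdist_def split: prod.splits if_splits)

text \<open>Where \<open>y < x\<close>, the bound x - y <= m - n is inherited from \<open>w\<close>;
  where \<open>x \<le> y\<close>, it follows from \<open>n \<le> m\<close>.\<close>

lemma ple_points:
  assumes "n \<le> m" "w \<in> points m n" "ple p w"
  shows "p \<in> points m n"
  using assms by (auto simp: points_def ple_def split: prod.splits)

lemma pdist_eq_0: "ple p w \<Longrightarrow> pdist p w = 0 \<longleftrightarrow> p = w"
  by (auto simp: ple_def pdist_def split: prod.splits if_splits)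

lemma ple_first_step:
  assumes "w \<in> points m n" "ple p w" "p \<noteq> w"
  shows "\<exists>z. pstep m n p z \<and> ple z w \<and> pdist p w = Suc (pdist z w)"
proof -
  obtain x y x' y' where xy: "p = (x, y)" "w = (x', y')" by force
  have h: "y' \<le> n" "x' + n \<le> y' + m" "x \<le> x'" "y \<le> y'" "y < x \<Longrightarrow> x + y' \<le> x' + y"
    using assms xy by (auto simp: points_def ple_def)
  consider "y < x" "x + y' < x' + y" | "y < x" "x + y' = x' + y" | "x \<le> y" "y < y'" | "x \<le> y" "y = y'"
    using h by linarith
  then show ?thesis
  proof cases
    case 1
    then show ?thesis
      using h xy by (intro exI[of _ "(Suc x, y)"]) (auto simp: pstep_def ple_def pdist_def)
  next
    case 2
    moreover from this have "y < y'" using h xy assms(3) by auto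
    ultimately show ?thesis
      using h xy by (intro exI[of _ "(Suc x, Suc y)"]) (auto simp: pstep_def ple_def pdist_def)
  next
    case 3
    then show ?thesis
      using h xy by (intro exI[of _ "(x, Suc y)"]) (auto simp: pstep_def ple_def pdist_def)
  next
    case 4
    moreover from this have "x < x'" using h xy assms(3) by auto
    ultimately show ?thesis
      using h xy by (intro exI[of _ "(Suc x, y)"]) (auto simp: pstep_def ple_def pdist_def)
  qed
qed

section \<open>Transfer to the Tamari lattice\<close>

lemma tamari_le_subpart:
  assumes "n \<le> m"
  shows "tamari_le (two_part m n) tau mu \<longleftrightarrow>
    (\<exists>p w. tau = subpart m n p \<and> mu = subpart m n w \<and> w \<in> points m n \<and> ple p w)"
proof
  assume "tamari_le (two_part m n) tau mu"
  then have tau: "tau \<in> subpart m n ` points m n" and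
    "(is_rotation (two_part m n))\<^sup>*\<^sup>* tau mu"
    by (auto simp: tamari_le_def subpartitions_two_part[OF assms])
  from this(2,1) show "\<exists>p w. tau = subpart m n p \<and> mu = subpart m n w \<and> w \<in> points m n \<and> ple p w"
  proof (induction rule: rtranclp_induct)
    case base
    then show ?case using ple_refl by blast
  next
    case (step mu alpha)
    then obtain p w where pw: "tau = subpart m n p" "mu = subpart m n w" "w \<in> points m n" "ple p w"
      by blast
    have "is_rotation (two_part m n) (subpart m n w) alpha" using step.hyps(2) pw(2) by simp
    then obtain z where "pstep m n w z" "alpha = subpart m n z"
      unfolding is_rotation_subpart[OF assms pw(3)] by blast
    moreover from this have "ple p z" using pw(4) pstep_ple ple_trans by blast
    ultimately show ?case using pw(1,3) pstep_points by blast
  qed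
next
  assume "\<exists>p w. tau = subpart m n p \<and> mu = subpart m n w \<and> w \<in> points m n \<and> ple p w"
  then obtain p w where pw: "tau = subpart m n p" "mu = subpart m n w" "w \<in> points m n" "ple p w"
    by blast
  have "(is_rotation (two_part m n))\<^sup>*\<^sup>* (subpart m n p) (subpart m n w)"
    using pw(4)
  proof (induction "pdist p w" arbitrary: p)
    case 0
    then show ?case using pdist_eq_0[of p w] by simp
  next
    case (Suc k)
    show ?case
    proof (cases "p = w")
      case False
      then obtain z where z: "pstep m n p z" "ple z w" "pdist p w = Suc (pdist z w)"
        using ple_first_step[OF pw(3) Suc.prems] by blast
      then have "is_rotation (two_part m n) (subpart m n p) (subpart m n z)"
        unfolding is_rotation_subpart[OF assms ple_points[OF assms pw(3) Suc.prems]] by blast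
      moreover have "(is_rotation (two_part m n))\<^sup>*\<^sup>* (subpart m n z) (subpart m n w)"
        using Suc z by simp
      ultimately show ?thesis by (rule converse_rtranclp_into_rtranclp)
    qed simp
  qed
  then show "tamari_le (two_part m n) tau mu"
    using pw ple_points[OF assms pw(3,4)] by (auto simp: tamari_le_def subpartitions_two_part[OF assms])
qed

lemma tamari_le_subpart_iff:
  assumes "n \<le> m" "p \<in> points m n" "w \<in> points m n"
  shows "tamari_le (two_part m n) (subpart m n p) (subpart m n w) \<longleftrightarrow> ple p w"
proof
  assume "tamari_le (two_part m n) (subpart m n p) (subpart m n w)"
  then obtain p' w' where h: "subpart m n p = subpart m n p'" "subpart m n w = subpart m n w'"
    "w' \<in> points m n" "ple p' w'"
    using tamari_le_subpart[OF assms(1)] by blast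
  have "p = p'" "w = w'"
    using inj_onD[OF inj_on_subpart h(1) assms(2) ple_points[OF assms(1) h(3,4)]]
      inj_onD[OF inj_on_subpart h(2) assms(3) h(3)] .
  then show "ple p w" using h by simp
qed (use assms tamari_le_subpart in blast)

lemma tamari_less_rel_subpart_iff:
  assumes "n \<le> m" "p \<in> points m n" "w \<in> points m n"
  shows "(subpart m n p, subpart m n w) \<in> tamari_less_rel (two_part m n) \<longleftrightarrow> ple p w \<and> p \<noteq> w"
  unfolding tamari_less_rel_def
  using tamari_le_subpart_iff[OF assms] inj_onD[OF inj_on_subpart _ assms(2,3)] by auto

lemma tamari_le_trans: "tamari_le lam a b \<Longrightarrow> tamari_le lam b c \<Longrightarrow> tamari_le lam a c"
  by (auto simp: tamari_le_def)

text \<open>The rotations given by \<open>ple_first_step\<close> form a chain of length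
  \<open>pdist p w\<close>, and by \<open>pdist_superadditive\<close> no chain is longer.\<close>

lemma tamari_dist_subpart:
  assumes "n \<le> m" "w \<in> points m n" "ple p w"
  shows "tamari_dist (two_part m n) (subpart m n p) (subpart m n w) = pdist p w"
  unfolding tamari_dist_def
proof (rule Greatest_equality)
  let ?R = "tamari_less_rel (two_part m n)"
  have "(subpart m n p, subpart m n w) \<in> ?R ^^ k" if "pdist p w = k" "ple p w" for k p
    using that
  proof (induction k arbitrary: p)
    case 0
    then show ?case using pdist_eq_0[of p w] by simp
  next
    case (Suc k)
    then have "p \<noteq> w" using pdist_eq_0[of p w] by simp
    then obtain z where z: "pstep m n p z" "ple z w" "pdist p w = Suc (pdist z w)"
      using ple_first_step[OF assms(2) Suc.prems(2)] by blast
    then have "(subpart m n p, subpart m n z) \<in> ?R"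
      using tamari_less_rel_subpart_iff[OF assms(1) ple_points[OF assms(1,2)] ple_points[OF assms(1,2)]]
        Suc.prems(2) pstep_ple by blast
    moreover have "(subpart m n z, subpart m n w) \<in> ?R ^^ k" using Suc z by simp
    ultimately show ?case by (rule relpow_Suc_I2)
  qed
  then show "(subpart m n p, subpart m n w) \<in> ?R ^^ pdist p w" using assms by blast
  have "k \<le> pdist p w" if "(subpart m n p, subpart m n w) \<in> ?R ^^ k" "ple p w" for k p
    using that
  proof (induction k arbitrary: p)
    case (Suc k)
    from relpow_Suc_D2[OF Suc.prems(1)] obtain nu where
      nu: "(subpart m n p, nu) \<in> ?R" "(nu, subpart m n w) \<in> ?R ^^ k" by blast
    then have "nu \<in> subpartitions (two_part m n)"
      by (simp add: tamari_less_rel_def tamari_le_def)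
    then obtain z where z: "nu = subpart m n z" "z \<in> points m n"
      using subpartitions_two_part[OF assms(1)] by blast
    have pz: "ple p z" "p \<noteq> z"
      using nu(1) z tamari_less_rel_subpart_iff[OF assms(1) ple_points[OF assms(1,2) Suc.prems(2)] z(2)]
      by auto
    \<comment> \<open>Superadditivity needs \<open>ple z w\<close>, which the rest of the chain
      yields by transitivity.\<close>
    have "tamari_le (two_part m n) nu (subpart m n w)" if "(nu, subpart m n w) \<in> ?R ^^ k" for k nu
      using that
    proof (induction k arbitrary: nu)
      case 0
      then show ?case
        using tamari_le_subpart_iff[OF assms(1,2,2)] ple_refl by simp
    next
      case (Suc k)
      from relpow_Suc_D2[OF Suc.prems] show ?case
        using Suc.IH tamari_le_trans by (auto simp: tamari_less_rel_def)
    qed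
    then have "ple z w"
      using nu(2) z tamari_le_subpart_iff[OF assms(1) z(2) assms(2)] by blast
    then show ?case
      using Suc.IH[of z] nu(2) z pdist_superadditive[OF pz] by fastforce
  qed simp
  then show "\<And>k. (subpart m n p, subpart m n w) \<in> ?R ^^ k \<Longrightarrow> k \<le> pdist p w" using assms by blast
qed

lemma bij_betw_tamari_intervals:
  assumes "n \<le> m"
  shows "bij_betw (map_prod (subpart m n) (subpart m n))
    {(p, w). w \<in> points m n \<and> ple p w} (tamari_intervals (two_part m n))"
proof (rule bij_betw_imageI)
  have "{(p, w). w \<in> points m n \<and> ple p w} \<subseteq> points m n \<times> points m n"
    using ple_points[OF assms] by blast
  then show "inj_on (map_prod (subpart m n) (subpart m n)) {(p, w). w \<in> points m n \<and> ple p w}"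
    using map_prod_inj_on[OF inj_on_subpart inj_on_subpart] inj_on_subset by blast
  show "map_prod (subpart m n) (subpart m n) ` {(p, w). w \<in> points m n \<and> ple p w} =
      tamari_intervals (two_part m n)"
    unfolding tamari_intervals_def tamari_le_subpart[OF assms]
    by (force simp: image_iff)
qed

section \<open>Labels of the top-down tableau\<close>

lemma num_rows_two_part:
  assumes "b \<le> a"
  shows "num_rows (\<lambda>l. two_part a b l - p) = (if p < b then 2 else if p < a then 1 else 0)"
proof -
  have "{l. two_part a b l - p \<noteq> 0} = (if p < b then {0, 1} else if p < a then {0} else {})"
    using assms by (auto simp: two_part_def)
  then show ?thesis unfolding num_rows_def by simp
qed

text \<open>
  While both rows are nonempty, the labelling alternates between them.
\<close>

definition nth_cell :: "nat \<Rightarrow> nat \<Rightarrow> nat \<Rightarrow> nat \<times> nat" where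
  "nth_cell m n i =
     (if i < 2 * n then if even i then (1, n - 1 - i div 2) else (0, m - 1 - i div 2)
      else (0, m - 1 - (i - n)))"

text \<open>Each of the first \<open>n\<close> rounds takes two cells and each later one a single
  cell, so \<open>k\<close> rounds take \<open>k + min k n\<close>.\<close>

lemma concat_last_cells_two_part:
  assumes "n \<le> m" "k \<le> m"
  shows "concat (map (\<lambda>p. last_cells (\<lambda>l. two_part m n l - p)) [0..<k]) =
    map (nth_cell m n) [0..<k + min k n]"
  using assms(2)
proof (induction k)
  case (Suc k)
  have "last_cells (\<lambda>l. two_part m n l - k) =
      map (nth_cell m n) [k + min k n..<Suc k + min (Suc k) n]"
  proof (cases "k < n")
    case True
    then have "[k + min k n..<Suc k + min (Suc k) n] = [2 * k, Suc (2 * k)]"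
      by (simp add: mult_2 upt_rec)
    moreover have "last_cells (\<lambda>l. two_part m n l - k) = [(1, n - k - 1), (0, m - k - 1)]"
      using True assms(1) unfolding last_cells_def num_rows_two_part[OF assms(1)]
      by (simp add: two_part_def numeral_2_eq_2)
    ultimately show ?thesis using True by (simp add: nth_cell_def)
  next
    case False
    then have "[k + min k n..<Suc k + min (Suc k) n] = [k + n]"
      by (simp add: upt_rec min_def)
    moreover have "last_cells (\<lambda>l. two_part m n l - k) = [(0, m - k - 1)]"
      using False Suc.prems unfolding last_cells_def num_rows_two_part[OF assms(1)]
      by (simp add: two_part_def)
    ultimately show ?thesis using False by (simp add: nth_cell_def)
  qed
  moreover have "[0..<Suc k + min (Suc k) n] =
      [0..<k + min k n] @ [k + min k n..<Suc k + min (Suc k) n]"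
    using upt_add_eq_append[of 0 "k + min k n" "Suc k + min (Suc k) n - (k + min k n)"]
    by (simp del: upt_Suc)
  ultimately show ?case using Suc by (simp del: upt_Suc add: upt_Suc_append[of 0 k])
qed simp

lemma top_down_order_two_part:
  "n \<le> m \<Longrightarrow> top_down_order (two_part m n) = map (nth_cell m n) [0..<m + n]"
  unfolding top_down_order_def using concat_last_cells_two_part[of n m m]
  by (simp add: two_part_def)

lemma card_cells_two_part: "card (cells (two_part B A)) = B + A"
  unfolding cells_two_part by (subst card_Un_disjoint) (auto simp: card_cartesian_product)

lemma inj_on_nth_cell:
  assumes "n \<le> m"
  shows "inj_on (nth_cell m n) {..<m + n}"
proof (rule inj_on_inverseI)
  fix i assume i: "i \<in> {..<m + n}"
  \<comment> \<open>A left inverse: row 1 takes the even positions below 2n, the last n cells of row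
    0 the odd ones, and the remaining cells of row 0 follow.\<close>
  let ?g = "\<lambda>(l :: nat, c). if l = 1 then 2 * (n - 1 - c)
    else if m - 1 - c < n then 2 * (m - 1 - c) + 1 else m - 1 - c + n"
  consider u where "i = 2 * u" "u < n" | u where "i = 2 * u + 1" "u < n" | "2 * n \<le> i"
    by (cases "i < 2 * n"; cases "even i") (auto elim!: evenE oddE)
  then show "?g (nth_cell m n i) = i"
    using i assms by cases (auto simp: nth_cell_def)
qed

lemma top_down_nth_cell:
  assumes "n \<le> m" "i < m + n"
  shows "top_down (two_part m n) (nth_cell m n i) = m + n - i"
proof -
  let ?xs = "map (nth_cell m n) [0..<m + n]" and ?ys = "rev [1..<Suc (m + n)]"
  have "distinct ?xs"
    using inj_on_nth_cell[OF assms(1)] by (simp add: distinct_map atLeast0LessThan)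
  then have "map_of (zip ?xs ?ys) (?xs ! i) = Some (?ys ! i)"
    using assms(2) by (intro map_of_zip_nth) (auto simp del: upt_Suc)
  then show ?thesis
    using assms unfolding top_down_def top_down_order_two_part[OF assms(1)] card_cells_two_part
    by (simp add: rev_nth del: upt_Suc)
qed

lemma top_down_row_1:
  assumes "n \<le> m" "c < n"
  shows "top_down (two_part m n) (1, c) = m - n + 2 * c + 2"
proof -
  have "nth_cell m n (2 * (n - 1 - c)) = (1, c)" "2 * (n - 1 - c) < m + n"
    using assms by (auto simp: nth_cell_def)
  then show ?thesis using top_down_nth_cell[OF assms(1), of "2 * (n - 1 - c)"] assms by simp
qed

text \<open>Labels increase along the row, and for \<open>c < n\<close> that of
  \<open>(0, c + (m - n))\<close> is one less than that of \<open>(1, c)\<close>. This decides all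
  comparisons of labels below.\<close>

lemma top_down_row_0:
  assumes "n \<le> m" "c < m"
  shows "top_down (two_part m n) (0, c) = (if c < m - n then c + 1 else 2 * c + 1 - (m - n))"
proof (cases "c < m - n")
  case True
  then have "nth_cell m n (m - 1 - c + n) = (0, c)" "m - 1 - c + n < m + n"
    using assms by (auto simp: nth_cell_def)
  then show ?thesis using top_down_nth_cell[OF assms(1), of "m - 1 - c + n"] True by simp
next
  case False
  then have "nth_cell m n (2 * (m - 1 - c) + 1) = (0, c)" "2 * (m - 1 - c) + 1 < m + n"
    using assms by (auto simp: nth_cell_def)
  then show ?thesis using top_down_nth_cell[OF assms(1), of "2 * (m - 1 - c) + 1"] False assms by simp
qed

section \<open>Deficit cells and the statistic \<open>sim\<close>\<close>

text \<open>Labels increase along rows, so only pairs from different rows count, and each gives the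
  cell of row 0 below its member in row 1. In the first range that member lies in the subpartition,
  in the second outside it.\<close>

lemma deficit_cells_two_part:
  assumes "n \<le> m" "a \<le> m" "b \<le> n" "b \<le> a"
  shows "deficit_cells (two_part m n) (top_down (two_part m n)) (two_part a b) =
    {0} \<times> ({a - (m - n)..<b} \<union> {b..<a - 1 - (m - n)})" (is "?D = ?E")
proof (intro equalityI subsetI)
  fix d assume "d \<in> ?D"
  then obtain i1 j1 i2 j2 where d: "d = (min i1 i2, min j1 j2)"
    and c1: "(i1, j1) \<in> cells (two_part a b)"
    and c2: "(i2, j2) \<in> cells (two_part m n)" "(i2, j2) \<notin> cells (two_part a b)"
    and gt: "top_down (two_part m n) (i1, j1) > top_down (two_part m n) (i2, j2)"
    unfolding deficit_cells_def by blast
  consider "i1 = 0" "j1 < a" "i2 = 0" "a \<le> j2" "j2 < m"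
    | "i1 = 0" "j1 < a" "i2 = 1" "b \<le> j2" "j2 < n"
    | "i1 = 1" "j1 < b" "i2 = 0" "a \<le> j2" "j2 < m"
    | "i1 = 1" "j1 < b" "i2 = 1" "b \<le> j2" "j2 < n"
    using c1 c2 by (auto simp: cells_two_part)
  then show "d \<in> ?E"
    using gt d assms
    by cases (auto simp: top_down_row_0 top_down_row_1[unfolded One_nat_def] split: if_splits)
next
  fix d assume "d \<in> ?E"
  then obtain c where d: "d = (0, c)"
    and "a - (m - n) \<le> c \<and> c < b \<or> b \<le> c \<and> c < a - 1 - (m - n)" by auto
  then consider "a - (m - n) \<le> c" "c < b" | "b \<le> c" "c < a - 1 - (m - n)" by blast
  then show "d \<in> ?D"
  proof cases
    case 1
    \<comment> \<open>\<open>(0, a)\<close> has the least label in row 0 outside the subpartition;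
      it exists as a <= c + (m - n) < m.\<close>
    then have "top_down (two_part m n) (1, c) > top_down (two_part m n) (0, a)" "a < m"
      using assms by (auto simp: top_down_row_0 top_down_row_1[unfolded One_nat_def])
    moreover have "(1, c) \<in> cells (two_part a b)" "(0, a) \<in> cells (two_part m n) - cells (two_part a b)"
      using 1 \<open>a < m\<close> by (auto simp: cells_two_part)
    moreover have "d = (min 1 0, min c a)" using d 1 assms by simp
    ultimately show ?thesis unfolding deficit_cells_def by blast
  next
    case 2
    \<comment> \<open>\<open>(0, c + 1 + (m - n))\<close> is the first cell of row 0 whose label
      exceeds that of \<open>(1, c)\<close>.\<close>
    then have "top_down (two_part m n) (0, c + 1 + (m - n)) > top_down (two_part m n) (1, c)"
      using assms by (auto simp: top_down_row_0 top_down_row_1[unfolded One_nat_def])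
    moreover have "(0, c + 1 + (m - n)) \<in> cells (two_part a b)"
      "(1, c) \<in> cells (two_part m n) - cells (two_part a b)"
      using 2 assms by (auto simp: cells_two_part)
    moreover have "d = (min 0 1, min (c + 1 + (m - n)) c)" using d by simp
    ultimately show ?thesis unfolding deficit_cells_def by blast
  qed
qed

text \<open>On \<open>points\<close> the three cases have y - x - 1, x - y and n - y deficit cells.
  The values in the first two are at least m - n and of opposite parity; in the third they are below
  m - n.\<close>

definition psim :: "nat \<Rightarrow> nat \<Rightarrow> nat \<times> nat \<Rightarrow> nat" where
  "psim m n = (\<lambda>(x, y). if x < y then m + n + 1 - 2 * y else if x \<le> n then m + n - 2 * x else m - x)"

lemma sim_subpart:
  assumes "n \<le> m" "w \<in> points m n"
  shows "sim (two_part m n) (top_down (two_part m n)) (subpart m n w) = psim m n w"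
proof -
  obtain x y where w: "w = (x, y)" "y \<le> n" "x + n \<le> y + m"
    using assms by (auto simp: points_def)
  let ?a = "m - x" and ?b = "n - y"
  let ?D = "{0} \<times> ({?a - (m - n)..<?b} \<union> {?b..<?a - 1 - (m - n)}) :: (nat \<times> nat) set"
  have "sim (two_part m n) (top_down (two_part m n)) (subpart m n w) =
      card (cells (two_part ?a ?b) - ?D)"
    using w assms deficit_cells_two_part[of n m ?a ?b] by (simp add: sim_def subpart_def)
  also have "\<dots> = ?a + ?b - card ?D"
    using w assms by (subst card_Diff_subset) (auto simp: card_cells_two_part, auto simp: cells_two_part)
  also have "card ?D = (?b - (?a - (m - n))) + (?a - 1 - (m - n) - ?b)"
    by (simp add: card_cartesian_product card_Un_disjoint)
  also have "?a + ?b - \<dots> = psim m n w"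
    using w assms by (auto simp: psim_def)
  finally show ?thesis .
qed

section \<open>The sum over intervals\<close>

text \<open>The pairs below (x, y) split into families indexed by \<open>i\<close>, on each of which
  the distance takes every value of a segment exactly once.\<close>

lemma sum_pdist_lower_set:
  fixes q :: "'a::comm_ring_1"
  shows "(\<Sum>p | ple p (x, y). q ^ pdist p (x, y)) =
    (\<Sum>i\<le>min x y. geom q ((x - y) + (y - x) + 2 * i + 1) - geom q i)"
proof -
  have "(\<Sum>p | ple p (x, y). q ^ pdist p (x, y)) =
    (\<Sum>(i, k) \<in> (SIGMA i:{..min x y}. {i..(x - y) + (y - x) + 2 * i}). q ^ k)"
  proof (cases "y \<le> x")
    case True
    \<comment> \<open>A family runs through pairs (a, b) with b = y - i while b < a; from distance i
      + (x - y) on it continues with a = y - i, where a <= b.\<close>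
    show ?thesis
      by (rule sum.reindex_bij_witness[where
            j = "\<lambda>p. (if snd p < fst p then y - snd p else y - fst p, pdist p (x, y))" and
            i = "\<lambda>(i, k). if k < i + (x - y) then (x - k, y - i) else (y - i, x + i - k)"])
        (use True in \<open>auto simp: ple_def pdist_def split: if_splits\<close>)
  next
    case False
    \<comment> \<open>No pair (a, b) below (x, y) has b < a here, as a - b would be at most x - y <
      0; a family is given by a = x - i.\<close>
    show ?thesis
      by (rule sum.reindex_bij_witness[where
            j = "\<lambda>p. (x - fst p, pdist p (x, y))" and
            i = "\<lambda>(i, k). (x - i, y + i - k)"])
        (use False in \<open>auto simp: ple_def pdist_def split: if_splits\<close>)
  qed
  also have "\<dots> = (\<Sum>i\<le>min x y. \<Sum>k = i..(x - y) + (y - x) + 2 * i. q ^ k)"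
    by (simp add: sum.Sigma[symmetric])
  also have "\<dots> = (\<Sum>i\<le>min x y. geom q ((x - y) + (y - x) + 2 * i + 1) - geom q i)"
    by (intro sum.cong refl sum_power_atLeastAtMost) simp
  finally show ?thesis .
qed

lemma sum_tamari_intervals:
  fixes q t :: "'a::comm_ring_1"
  assumes "n \<le> m"
  shows "(\<Sum>(tau, mu) \<in> tamari_intervals (two_part m n).
       q ^ tamari_dist (two_part m n) tau mu *
       t ^ sim (two_part m n) (top_down (two_part m n)) mu) =
    (\<Sum>(x, y) \<in> points m n. \<Sum>i\<le>min x y.
       t ^ psim m n (x, y) * (geom q ((x - y) + (y - x) + 2 * i + 1) - geom q i))"
proof -
  have fin: "finite {p. ple p w}" for w
    by (rule finite_subset[of _ "{..fst w} \<times> {..snd w}"]) (auto simp: ple_def)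
  have "(\<Sum>(tau, mu) \<in> tamari_intervals (two_part m n).
       q ^ tamari_dist (two_part m n) tau mu *
       t ^ sim (two_part m n) (top_down (two_part m n)) mu) =
    (\<Sum>(p, w) | w \<in> points m n \<and> ple p w. q ^ pdist p w * t ^ psim m n w)"
    unfolding sum.reindex_bij_betw[OF bij_betw_tamari_intervals[OF assms], symmetric]
    by (rule sum.cong) (auto simp: tamari_dist_subpart[OF assms] sim_subpart[OF assms])
  also have "\<dots> = (\<Sum>(w, p) \<in> (SIGMA w:points m n. {p. ple p w}). t ^ psim m n w * q ^ pdist p w)"
    by (rule sum.reindex_bij_witness[where j = prod.swap and i = prod.swap]) (auto simp: mult.commute)
  also have "\<dots> = (\<Sum>w \<in> points m n. t ^ psim m n w * (\<Sum>p | ple p w. q ^ pdist p w))"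
    by (simp add: sum.Sigma[symmetric] finite_points fin sum_distrib_left)
  also have "\<dots> = (\<Sum>(x, y) \<in> points m n. \<Sum>i\<le>min x y.
       t ^ psim m n (x, y) * (geom q ((x - y) + (y - x) + 2 * i + 1) - geom q i))"
    by (intro sum.cong refl) (auto simp: sum_pdist_lower_set sum_distrib_left[symmetric])
  finally show ?thesis .
qed

section \<open>Matching the ends of the segments\<close>

text \<open>Upper and lower ends are summed separately. The hypothesis
  \<open>2 * n \<le> m + 1\<close> lets triples return to \<open>points\<close>: if m + n - T = 2k
  with k <= n and d <= k, then min d T <= m - n, because k = n gives T = m - n and k < n gives d <=
  n - 1 <= m - n. It also gives d <= T in the region x < y.\<close>

lemma sum_interval_schur_geom:
  fixes q t :: "'a::comm_ring_1"
  assumes "n \<le> m" "2 * n \<le> m + 1"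
  shows "(\<Sum>(x, y) \<in> points m n. \<Sum>i\<le>min x y.
       t ^ psim m n (x, y) * (geom q ((x - y) + (y - x) + 2 * i + 1) - geom q i)) =
    (\<Sum>d\<le>n. schur_geom q t (m + n - 2 * d) d)"
proof -
  define I where "I = (SIGMA w:points m n. {..min (fst w) (snd w)})"
  define J where "J = (SIGMA d:{..n}. SIGMA T:{..m + n - 2 * d}. {..min d T})"
  have I: "((x, y), i) \<in> I \<longleftrightarrow> y \<le> n \<and> x + n \<le> y + m \<and> i \<le> x \<and> i \<le> y" for x y i
    by (auto simp: I_def points_def)
  have J: "(d, T, r) \<in> J \<longleftrightarrow> d \<le> n \<and> T + 2 * d \<le> m + n \<and> r \<le> d \<and> r \<le> T" for d T r
    using assms by (auto simp: J_def)
  have I_cases: thesis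
    if "a \<in> I"
      and "\<And>x y i. a = ((x, y), i) \<Longrightarrow> n < x \<Longrightarrow> a \<in> I \<Longrightarrow> thesis"
      and "\<And>x y i. a = ((x, y), i) \<Longrightarrow> y \<le> x \<Longrightarrow> x \<le> n \<Longrightarrow> a \<in> I \<Longrightarrow> thesis"
      and "\<And>x y i. a = ((x, y), i) \<Longrightarrow> x < y \<Longrightarrow> a \<in> I \<Longrightarrow> thesis"
    for a thesis
    using that by (metis linorder_not_less surj_pair)
  \<comment> \<open>For \<open>T\<close> at least m - n, parity tells \<open>y \<le> x\<close> from
    \<open>x < y\<close>, and the half recovers \<open>x\<close> in the first case. In the second, T
    = m + n + 1 - 2y leaves 2(y - 1) + 1, so the half is y - 1.\<close>
  define e where "e T \<longleftrightarrow> even (m + n - T)" for T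
  define h where "h T = (m + n - T) div 2" for T
  have h: "e (m + n - 2 * k)" "h (m + n - 2 * k) = k" if "2 * k \<le> m + n" for k
    using that by (auto simp: e_def h_def)
  have h': "\<not> e (Suc (m + n) - 2 * k)" "h (Suc (m + n) - 2 * k) = k - 1"
    if "1 \<le> k" "2 * k \<le> Suc (m + n)" for k
  proof -
    have "m + n - (Suc (m + n) - 2 * k) = 2 * (k - 1) + 1" using that by simp
    then show "\<not> e (Suc (m + n) - 2 * k)" "h (Suc (m + n) - 2 * k) = k - 1"
      unfolding e_def h_def by simp_all
  qed
  have J_cases: thesis
    if "b \<in> J"
      and "\<And>d T r. b = (d, T, r) \<Longrightarrow> T + n < m \<Longrightarrow> b \<in> J \<Longrightarrow> thesis"
      and "\<And>d T r. b = (d, T, r) \<Longrightarrow> m \<le> T + n \<Longrightarrow> T + 2 * h T = m + n \<Longrightarrow> e T \<Longrightarrow> b \<in> J \<Longrightarrow> thesis"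
      and "\<And>d T r. b = (d, T, r) \<Longrightarrow> m \<le> T + n \<Longrightarrow> T + 2 * h T + 1 = m + n \<Longrightarrow> \<not> e T \<Longrightarrow> b \<in> J \<Longrightarrow> thesis"
    for b thesis
  proof -
    obtain d T r where b: "b = (d, T, r)" using prod_cases3 by blast
    then have "T \<le> m + n" using that(1) J by simp
    then have "if e T then T + 2 * h T = m + n else T + 2 * h T + 1 = m + n"
      unfolding e_def h_def by presburger
    then show thesis using that b by (cases "T + n < m") (auto simp: not_less split: if_splits)
  qed
  note case_simps = I J psim_def h h'
  \<comment> \<open>The matching of upper ends and the matching of lower ends are different bijections;
    in both, \<open>T\<close> is the statistic \<open>psim\<close>, whose value and parity tell the three regions apart.\<close>
  have pos: "(\<Sum>((x, y), i) \<in> I. t ^ psim m n (x, y) * geom q ((x - y) + (y - x) + 2 * i + 1)) =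
      (\<Sum>(d, T, r) \<in> J. t ^ T * geom q (m + n - 2 * d + r - T + 1))"
  proof (rule sum.reindex_bij_witness[where
          j = "\<lambda>((x, y), i).
            if n < x then (n - i, m - x, n - y)
            else if y \<le> x then (x - i, m + n - 2 * x, x - y)
            else (y - 1 - i, m + n + 1 - 2 * y, y - 1 - x)" and
          i = "\<lambda>(d, T, r).
            if T + n < m then ((m - T, n - r), n - d)
            else if e T then ((h T, h T - r), h T - d)
            else ((h T - r, h T + 1), h T - d)"], goal_cases)
    case (1 a)
    then show ?case by (rule I_cases) (use assms in \<open>auto simp: case_simps\<close>)
  next
    case (2 a)
    then show ?case by (rule I_cases) (use assms in \<open>auto simp: case_simps\<close>)
  next
    case (3 b)
    then show ?case by (rule J_cases) (use assms in \<open>auto simp: case_simps\<close>)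
  next
    case (4 b)
    then show ?case by (rule J_cases) (use assms in \<open>auto simp: case_simps\<close>)
  next
    case (5 a)
    then show ?case by (rule I_cases) (use assms in \<open>auto simp: case_simps intro!: arg_cong2[of _ _ _ _ "(*)"] arg_cong[of _ _ "geom q"]\<close>)
  qed
  have neg: "(\<Sum>((x, y), i) \<in> I. t ^ psim m n (x, y) * geom q i) =
      (\<Sum>(d, T, r) \<in> J. t ^ T * geom q (r + (d - T)))"
  proof (rule sum.reindex_bij_witness[where
          j = "\<lambda>((x, y), i).
            if n < x then (i + n - y, m - x, i - ((i + n - y) - (m - x)))
            else if y \<le> x then (x - y + i, m + n - 2 * x, i - ((x - y + i) - (m + n - 2 * x)))
            else (y - 1 - x + i, m + n + 1 - 2 * y, i)" and
          i = "\<lambda>(d, T, r).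
            if T + n < m then ((m - T, n + (r + (d - T)) - d), r + (d - T))
            else if e T
            then ((h T, h T + (r + (d - T)) - d), r + (d - T))
            else ((h T + r - d, h T + 1), r)"], goal_cases)
    case (1 a)
    then show ?case by (rule I_cases) (use assms in \<open>auto simp: case_simps\<close>)
  next
    case (2 a)
    then show ?case by (rule I_cases) (use assms in \<open>auto simp: case_simps\<close>)
  next
    case (3 b)
    then show ?case by (rule J_cases) (use assms in \<open>auto simp: case_simps\<close>)
  next
    case (4 b)
    then show ?case by (rule J_cases) (use assms in \<open>auto simp: case_simps\<close>)
  next
    case (5 a)
    then show ?case by (rule I_cases) (use assms in \<open>auto simp: case_simps intro!: arg_cong2[of _ _ _ _ "(*)"] arg_cong[of _ _ "geom q"]\<close>)
  qed
  have "(\<Sum>(x, y) \<in> points m n. \<Sum>i\<le>min x y.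
       t ^ psim m n (x, y) * (geom q ((x - y) + (y - x) + 2 * i + 1) - geom q i)) =
     (\<Sum>((x, y), i) \<in> I. t ^ psim m n (x, y) * (geom q ((x - y) + (y - x) + 2 * i + 1) - geom q i))"
    unfolding I_def by (simp add: sum.Sigma finite_points case_prod_unfold)
  also have "\<dots> = (\<Sum>(d, T, r) \<in> J. t ^ T * (geom q (m + n - 2 * d + r - T + 1) - geom q (r + (d - T))))"
    using pos neg by (simp add: right_diff_distrib case_prod_unfold sum_subtractf)
  also have "\<dots> = (\<Sum>d\<le>n. schur_geom q t (m + n - 2 * d) d)"
    unfolding J_def schur_geom_def by (simp add: sum.Sigma)
  finally show ?thesis .
qed

theorem theorem5p10:
  fixes q t :: "'a::comm_ring_1" and m n :: nat
  assumes "m \<ge> n"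
    and "triangular (two_part m n)"
  shows "A_poly m n q t 1 =
    (\<Sum>(tau, mu) \<in> tamari_intervals (two_part m n).
       q ^ tamari_dist (two_part m n) tau mu *
       t ^ sim (two_part m n) (top_down (two_part m n)) mu)"
  using triangular_two_part[OF assms(2)]
  by (simp only: sum_tamari_intervals[OF assms(1)] sum_interval_schur_geom[OF assms(1)]
      A_poly_schur_geom[OF assms(1)])

end
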